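(* Let $(\boldsymbol V,\Phi)$ be an admissible primitive lattice substitution system such that no $\Psi_0[a]$ ($a\in L$) is a singleton set. If $\boldsymbol V$ consists of model sets (i.e. each $V_i$ is a model set), then $\Phi$ admits at least one pairwise coincidence in some $\Psi_0[a]$; that is, there are $j\neq k$ and $a\in L$ with $j,k\in\Psi_0[a]$ such that $\Phi_{ij}\cap\Phi_{ik}\neq\varnothing$ for some $i$.
   Context: A matrix function system (MFS) is an $m\times m$ matrix $\Phi=(\Phi_{ij})$ whose entries are finite (possibly empty) sets of maps $x\mapsto Qx+a_{ijk}$ on $\mathbb R^d$, where $Q$ is one fixed expansive linear map (all eigenvalues of modulus $>1$) and $a_{ijk}\in\mathbb R^d$. It is primitive if its substitution matrix $S(\Phi)=(\#\Phi_{ij})_{i,j}$ is primitive, i.e. some power has only strictly positive entries. Powers are defined by composition: $(\Phi^{k+1})_{ij}=\bigcup_{\ell}\{g\circ f : g\in(\Phi^k)_{i\ell},\ f\in\Phi_{\ell j}\}$. For $\boldsymbol V=(V_1,\dots,V_m)^T$ with $V_i\subset\mathbb R^d$, $\Phi\boldsymbol V=(W_1,\dots,W_m)$ with $W_i=\bigcup_j\bigcup_{f\in\Phi_{ij}}f(V_j)$. A lattice substitution system (LSS) with $m$ components is a pair $(\boldsymbol V,\Phi)$ with $\Phi\boldsymbol V=\boldsymbol V$, the $V_i$ mutually disjoint, the unions $V_i=\bigcup_{j}\bigcup_{f\in\Phi_{ij}}f(V_j)$ pairwise disjoint for every $i$, and $L:=\operatorname{supp}(\boldsymbol V)=\bigcup_iV_i$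 a lattice in $\mathbb R^d$. It is primitive if $\Phi$ is. Standing assumption: for every $r>0$, every $r$-cluster $(V_1\cap(x+r\mathbb B^d),\dots,V_m\cap(x+r\mathbb B^d))$ of $\boldsymbol V$ ($\mathbb B^d$ the closed unit ball) is, up to translation, contained in $\Phi^k(\boldsymbol v)$ for some $k\in\mathbb N$ and some single point $\boldsymbol v$ of some type $i$ (a vector of sets whose $i$-th entry is a one-point set, all others being empty). A primitive LSS is admissible if the translational parts of all maps in $\Phi$ belong to one fixed system of representatives (containing $0$) in $L$ of $L/QL$. Put $L_i=\langle V_i-V_i\rangle_{\mathbb Z}$, $L'=L_1+\dots+L_m$, and for $a\in L$ let $\Psi_0[a]=\{i : (a+L')\cap V_i\ne\varnothing\}\subset\{1,\dots,m\}$. Model sets: a cut and project scheme consists of a locally compact Abelian group $H$ and a lattice $\tilde L\subset\mathbb R^d\times H$ (discrete subgroup with compact quotient) such that the canonical projection $\pi:\mathbb R^d\times H\to\mathbb R^d$ is injective on $\tilde L$ and the canonical projection $\pi_{\rm int}:\mathbb R^d\times H\to H$ maps $\tilde L$ onto a dense subset of $H$. A model set in $\mathbb R^d$ is a set which, up to translation, has the form $\Lambda(\Omega)=\{\pi(x) : x\in\tilde L,\ \pi_{\rm int}(x)\in\Omega\}$ for some cut and project scheme, where $\Omega\subset H$ has nonempty interior and compact closure. *)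

theory Defs
  imports
    "HOL-Analysis.Analysis"
    "HOL-Algebra.Coset"
    "HOL-Computational_Algebra.Group_Closure"
begin

section \<open>Lattices and model sets\<close>

definition additive_group_of :: "'a::ab_group_add monoid"
  where "additive_group_of = \<lparr>carrier = UNIV, mult = (+), one = 0\<rparr>"

text \<open>As usual, locally compact Abelian groups are Hausdorff.\<close>

definition lca_group :: "'h monoid \<Rightarrow> 'h topology \<Rightarrow> bool"
  where "lca_group H T \<longleftrightarrow>
    comm_group H \<and>
    topspace T = carrier H \<and>
    continuous_map (prod_topology T T) T (\<lambda>(x, y). x \<otimes>\<^bsub>H\<^esub> y) \<and>
    continuous_map T T (\<lambda>x. inv\<^bsub>H\<^esub> x) \<and>
    Hausdorff_space T \<and>
    locally_compact_space T"

text \<open>The topology \<open>X\<close> below is the quotient topology on the cosets of \<open>L\<close>; it is the only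
  topology that makes the canonical projection a quotient map.\<close>

definition lattice_in :: "'g monoid \<Rightarrow> 'g topology \<Rightarrow> 'g set \<Rightarrow> bool"
  where "lattice_in G T L \<longleftrightarrow>
    subgroup L G \<and>
    subtopology T L = discrete_topology L \<and>
    (\<exists>X. quotient_map T X (\<lambda>x. L #>\<^bsub>G\<^esub> x) \<and> compact_space X)"

definition cut_and_project_scheme ::
    "'h monoid \<Rightarrow> 'h topology \<Rightarrow> ((real^'d) \<times> 'h) set \<Rightarrow> bool"
  where "cut_and_project_scheme H T L \<longleftrightarrow>
    lca_group H T \<and>
    lattice_in (additive_group_of \<times>\<times> H) (prod_topology euclidean T) L \<and>
    inj_on fst L \<and>
    T closure_of (snd ` L) = topspace T"

text \<open>The internal group is carried by a subset of the type \<open>'h\<close>. In a statement about finitely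
  many model sets with an unconstrained \<open>'h\<close>, each of them may have its own internal group, since
  some type is large enough to contain copies of all of these groups.\<close>

definition model_set :: "'h itself \<Rightarrow> (real^'d) set \<Rightarrow> bool"
  where "model_set (_ :: 'h itself) V \<longleftrightarrow>
    (\<exists>(H :: 'h monoid) T L \<Omega> t.
      cut_and_project_scheme H T L \<and>
      \<Omega> \<subseteq> carrier H \<and>
      T interior_of \<Omega> \<noteq> {} \<and>
      compactin T (T closure_of \<Omega>) \<and>
      V = (+) t ` {fst x |x. x \<in> L \<and> snd x \<in> \<Omega>})"


section \<open>Matrix function systems\<close>

text \<open>The index set \<open>{1,\<dots>,m}\<close> is rendered as a finite type \<open>'m\<close>.\<close>

type_synonym ('d, 'm) map_sets = "'m \<Rightarrow> 'm \<Rightarrow> ((real^'d) \<Rightarrow> (real^'d)) set"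

definition expansive :: "((real^'d) \<Rightarrow> (real^'d)) \<Rightarrow> bool"
  where "expansive Q \<longleftrightarrow>
    linear Q \<and>
    (\<forall>c v. v \<noteq> 0 \<and> map_matrix complex_of_real (matrix Q) *v v = c *s v \<longrightarrow> 1 < cmod c)"

definition mfs :: "((real^'d) \<Rightarrow> (real^'d)) \<Rightarrow> ('d, 'm::finite) map_sets \<Rightarrow> bool"
  where "mfs Q \<Phi> \<longleftrightarrow>
    expansive Q \<and>
    (\<forall>i j. finite (\<Phi> i j) \<and> (\<forall>f\<in>\<Phi> i j. \<exists>a. f = (\<lambda>x. Q x + a)))"

definition subst_matrix :: "('d, 'm::finite) map_sets \<Rightarrow> nat^'m^'m"
  where "subst_matrix \<Phi> = (\<chi> i j. card (\<Phi> i j))"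

definition primitive_matrix :: "nat^'m^'m \<Rightarrow> bool"
  where "primitive_matrix A \<longleftrightarrow> (\<exists>k>0. \<forall>i j. (((**) A ^^ k) (mat 1)) $ i $ j > 0)"

primrec mfs_power :: "('d, 'm::finite) map_sets \<Rightarrow> nat \<Rightarrow> ('d, 'm) map_sets"
  where
    "mfs_power \<Phi> 0 = (\<lambda>i j. if i = j then {id} else {})"
  | "mfs_power \<Phi> (Suc k) = (\<lambda>i j. \<Union>l. {g \<circ> f |g f. g \<in> mfs_power \<Phi> k i l \<and> f \<in> \<Phi> l j})"

definition mfs_apply ::
    "('d, 'm::finite) map_sets \<Rightarrow> ('m \<Rightarrow> (real^'d) set) \<Rightarrow> 'm \<Rightarrow> (real^'d) set"
  where "mfs_apply \<Phi> V = (\<lambda>i. \<Union>j. \<Union>f\<in>\<Phi> i j. f ` V j)"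


section \<open>Lattice substitution systems\<close>

definition supp :: "('m::finite \<Rightarrow> (real^'d) set) \<Rightarrow> (real^'d) set"
  where "supp V = (\<Union>i. V i)"

definition point_of_type :: "'m::finite \<Rightarrow> real^'d \<Rightarrow> 'm \<Rightarrow> (real^'d) set"
  where "point_of_type i p = (\<lambda>j. if j = i then {p} else {})"

definition clusters_legal ::
    "('m::finite \<Rightarrow> (real^'d) set) \<Rightarrow> ('d, 'm) map_sets \<Rightarrow> bool"
  where "clusters_legal V \<Phi> \<longleftrightarrow>
    (\<forall>r>0. \<forall>x. \<exists>k i p t. \<forall>j.
      (+) t ` (V j \<inter> cball x r) \<subseteq> mfs_apply (mfs_power \<Phi> k) (point_of_type i p) j)"

definition lss ::
    "((real^'d) \<Rightarrow> (real^'d)) \<Rightarrow> ('m::finite \<Rightarrow> (real^'d) set) \<Rightarrow> ('d, 'm) map_sets \<Rightarrow> bool"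
  where "lss Q V \<Phi> \<longleftrightarrow>
    mfs Q \<Phi> \<and>
    mfs_apply \<Phi> V = V \<and>
    disjoint_family V \<and>
    (\<forall>i. disjoint_family_on (\<lambda>(j, f). f ` V j) (SIGMA j:UNIV. \<Phi> i j)) \<and>
    lattice_in additive_group_of euclidean (supp V)"

definition representatives ::
    "((real^'d) \<Rightarrow> (real^'d)) \<Rightarrow> (real^'d) set \<Rightarrow> (real^'d) set \<Rightarrow> bool"
  where "representatives Q L D \<longleftrightarrow> D \<subseteq> L \<and> (\<forall>x\<in>L. \<exists>!d. d \<in> D \<and> x - d \<in> Q ` L)"

definition admissible_primitive_lss ::
    "((real^'d) \<Rightarrow> (real^'d)) \<Rightarrow> ('m::finite \<Rightarrow> (real^'d) set) \<Rightarrow> ('d, 'm) map_sets \<Rightarrow> bool"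
  where "admissible_primitive_lss Q V \<Phi> \<longleftrightarrow>
    lss Q V \<Phi> \<and>
    primitive_matrix (subst_matrix \<Phi>) \<and>
    (\<exists>D. representatives Q (supp V) D \<and> 0 \<in> D \<and>
      (\<forall>i j. \<forall>f\<in>\<Phi> i j. \<exists>a\<in>D. f = (\<lambda>x. Q x + a)))"

text \<open>The outer sum is the Minkowski sum of sets.\<close>

definition diff_module :: "('m::finite \<Rightarrow> (real^'d) set) \<Rightarrow> (real^'d) set"
  where "diff_module V = (\<Sum>i\<in>UNIV. group_closure {x - y |x y. x \<in> V i \<and> y \<in> V i})"

definition Psi0 :: "('m::finite \<Rightarrow> (real^'d) set) \<Rightarrow> real^'d \<Rightarrow> 'm set"
  where "Psi0 V a = {i. (+) a ` diff_module V \<inter> V i \<noteq> {}}"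

end

theory Submission
  imports Defs
begin

text \<open>
  Since all translation parts belong to one system of representatives \<open>D\<close> of \<open>L/QL\<close>, every point of
  \<open>L\<close> is uniquely of the form \<open>Q y + d\<close>, and its type is determined by \<open>d\<close> and the type of \<open>y\<close>. So the
  system is a coloring of \<open>L\<close> by types that obeys a substitution rule. Each \<open>V\<^sub>i\<close> lies in one coset of
  \<open>L'\<close>, and \<open>\<Psi>\<^sub>0[a]\<close> is the set of colors on \<open>a + L'\<close>. If there are no pairwise coincidences, then
  for each digit the rule is injective on the colors of each coset of \<open>L'\<close>, and so are
  its iterates. It is shown that \<open>L'\<close> then consists of periods of the coloring; every
  \<open>\<Psi>\<^sub>0[a]\<close> is then a singleton, which is excluded.

  A single \<open>V\<^sub>i\<close> that is a model set contains a point \<open>x\<close> and all its translates by sums of three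
  elements of a relatively dense symmetric set \<open>B\<close>: one takes the lattice points whose
  internal coordinate is small (\<open>model_set_almost_periods\<close>). By legality of clusters, the digit sums
  of some length \<open>k\<close> contain a patch of \<open>L\<close> that, together with \<open>B\<close>, covers \<open>L\<close>. For every \<open>y\<close> some
  point of the inflated block \<open>Q\<^sup>k y + e\<close> therefore falls into \<open>x + B\<close>. Comparing the blocks of \<open>y\<close> and
  \<open>y + v\<close> there and using injectivity, one sees that each \<open>v \<in> L'\<close> with \<open>Q\<^sup>k v \<in> B - B\<close> is an exact
  period of the coloring. There are so many of them that the group \<open>P\<close> of periods has finite index
  in \<open>L\<close> (\<open>almost_periods_imp_finite_index\<close>).

  Finally, let \<open>x\<close> and \<open>y\<close> have the same color and \<open>u = x - y\<close>. By injectivity and finiteness,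
  \<open>Q\<^sup>N u - u \<in> P\<close> for arbitrarily large \<open>N\<close>. As \<open>Q\<^sup>N x + e\<close> and \<open>Q\<^sup>N y + e\<close> have the same color for all digit
  sums \<open>e\<close> of length \<open>N\<close>, translation by \<open>u\<close> preserves the colors of all points \<open>Q\<^sup>N y + e\<close>, which
  represent all classes modulo \<open>P\<close>. Hence \<open>u \<in> P\<close>
  (\<open>finite_index_imp_color_module_periods\<close>), and these \<open>u\<close> generate \<open>L'\<close>.
\<close>

section \<open>Almost periods of model sets\<close>

lemma lca_group_open_translate:
  assumes H: "lca_group H T" and W: "openin T W" and l: "l \<in> carrier H"
  shows "openin T {h \<in> carrier H. h \<otimes>\<^bsub>H\<^esub> l \<in> W}"
proof -
  have mult: "continuous_map (prod_topology T T) T (\<lambda>(x, y). x \<otimes>\<^bsub>H\<^esub> y)"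
    and top: "topspace T = carrier H"
    using H by (auto simp: lca_group_def)
  have "continuous_map T (prod_topology T T) (\<lambda>h. (h, l))"
    using l top by (intro continuous_map_pairedI) auto
  from continuous_map_compose[OF this mult]
  have "continuous_map T T (\<lambda>h. h \<otimes>\<^bsub>H\<^esub> l)"
    by (simp add: o_def)
  from openin_continuous_map_preimage[OF this W] show ?thesis
    by (simp add: top)
qed

lemma lca_group_open_mult_nhd:
  assumes H: "lca_group H T" and U: "openin T U" and u: "u \<in> U"
  obtains U' W where "openin T U'" "u \<in> U'" "openin T W" "\<one>\<^bsub>H\<^esub> \<in> W"
    "\<And>a w. \<lbrakk>a \<in> U'; w \<in> W\<rbrakk> \<Longrightarrow> a \<otimes>\<^bsub>H\<^esub> w \<in> U"
proof -
  have mult: "continuous_map (prod_topology T T) T (\<lambda>(x, y). x \<otimes>\<^bsub>H\<^esub> y)"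
    and top: "topspace T = carrier H" and grp: "comm_group H"
    using H by (auto simp: lca_group_def)
  interpret comm_group H by (rule grp)
  have uH: "u \<in> carrier H" using U u top openin_subset by blast
  let ?P = "{p \<in> topspace (prod_topology T T). (case p of (x, y) \<Rightarrow> x \<otimes>\<^bsub>H\<^esub> y) \<in> U}"
  have "openin (prod_topology T T) ?P"
    using openin_continuous_map_preimage[OF mult U] .
  moreover have "(u, \<one>\<^bsub>H\<^esub>) \<in> ?P" using uH u by (simp add: top)
  ultimately obtain U' W where "openin T U'" "openin T W" "u \<in> U'" "\<one>\<^bsub>H\<^esub> \<in> W" "U' \<times> W \<subseteq> ?P"
    unfolding openin_prod_topology_alt by meson
  then show thesis by (intro that[of U' W]) auto
qed

text \<open>Three factors from \<open>W\<close> are allowed because three errors are made later: one in moving a point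
  near \<open>u\<close>, and two in comparing two elements that are both close to the same point.\<close>

lemma lca_group_symmetric_nhd:
  assumes H: "lca_group H T" and U: "openin T U" and u: "u \<in> U"
  obtains W where "openin T W" "\<one>\<^bsub>H\<^esub> \<in> W" "\<And>w. w \<in> W \<Longrightarrow> inv\<^bsub>H\<^esub> w \<in> W"
    "\<And>a b c. \<lbrakk>a \<in> W; b \<in> W; c \<in> W\<rbrakk> \<Longrightarrow> u \<otimes>\<^bsub>H\<^esub> a \<otimes>\<^bsub>H\<^esub> b \<otimes>\<^bsub>H\<^esub> c \<in> U"
proof -
  have inv_cont: "continuous_map T T (\<lambda>x. inv\<^bsub>H\<^esub> x)"
    and top: "topspace T = carrier H" and grp: "comm_group H"
    using H by (auto simp: lca_group_def)
  interpret comm_group H by (rule grp)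
  obtain U1 W1 where 1: "openin T U1" "u \<in> U1" "openin T W1" "\<one>\<^bsub>H\<^esub> \<in> W1"
    "\<And>a w. \<lbrakk>a \<in> U1; w \<in> W1\<rbrakk> \<Longrightarrow> a \<otimes>\<^bsub>H\<^esub> w \<in> U"
    using lca_group_open_mult_nhd[OF H U u] by blast
  obtain U2 W2 where 2: "openin T U2" "u \<in> U2" "openin T W2" "\<one>\<^bsub>H\<^esub> \<in> W2"
    "\<And>a w. \<lbrakk>a \<in> U2; w \<in> W2\<rbrakk> \<Longrightarrow> a \<otimes>\<^bsub>H\<^esub> w \<in> U1"
    using lca_group_open_mult_nhd[OF H 1(1,2)] by blast
  obtain U3 W3 where 3: "openin T U3" "u \<in> U3" "openin T W3" "\<one>\<^bsub>H\<^esub> \<in> W3"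
    "\<And>a w. \<lbrakk>a \<in> U3; w \<in> W3\<rbrakk> \<Longrightarrow> a \<otimes>\<^bsub>H\<^esub> w \<in> U2"
    using lca_group_open_mult_nhd[OF H 2(1,2)] by blast
  define W0 where "W0 = W1 \<inter> W2 \<inter> W3"
  have W0: "openin T W0" "\<one>\<^bsub>H\<^esub> \<in> W0" "W0 \<subseteq> carrier H"
    using 1 2 3 openin_subset[of T W1] top by (auto simp: W0_def)
  define W where "W = W0 \<inter> {x \<in> carrier H. inv\<^bsub>H\<^esub> x \<in> W0}"
  have "openin T {x \<in> carrier H. inv\<^bsub>H\<^esub> x \<in> W0}"
    using openin_continuous_map_preimage[OF inv_cont W0(1)] by (simp add: top)
  then have "openin T W" using W0 by (auto simp: W_def)
  moreover have "\<one>\<^bsub>H\<^esub> \<in> W" using W0 by (auto simp: W_def)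
  moreover have "inv\<^bsub>H\<^esub> w \<in> W" if "w \<in> W" for w using that by (auto simp: W_def)
  moreover have "u \<otimes>\<^bsub>H\<^esub> a \<otimes>\<^bsub>H\<^esub> b \<otimes>\<^bsub>H\<^esub> c \<in> U" if "a \<in> W" "b \<in> W" "c \<in> W" for a b c
  proof -
    have "u \<otimes>\<^bsub>H\<^esub> a \<in> U2" using 3(2,5) that by (auto simp: W_def W0_def)
    then have "u \<otimes>\<^bsub>H\<^esub> a \<otimes>\<^bsub>H\<^esub> b \<in> U1" using 2(5) that by (auto simp: W_def W0_def)
    then show ?thesis using 1(5) that by (auto simp: W_def W0_def)
  qed
  ultimately show thesis using that by blast
qed

lemma cut_and_project_subgroup:
  fixes L :: "((real^'d) \<times> 'h) set"
  assumes cps: "cut_and_project_scheme H T L" and p: "p \<in> L" and q: "q \<in> L"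
  shows "snd p \<in> carrier H" "(0, \<one>\<^bsub>H\<^esub>) \<in> L"
    "(fst p + fst q, snd p \<otimes>\<^bsub>H\<^esub> snd q) \<in> L" "(- fst p, inv\<^bsub>H\<^esub> snd p) \<in> L"
proof -
  let ?A = "additive_group_of :: (real^'d) monoid"
  have "comm_group H" using cps by (auto simp: cut_and_project_scheme_def lca_group_def)
  then interpret H: comm_group H .
  have A: "group ?A"
    by (rule groupI) (auto simp: additive_group_of_def add.assoc intro: exI[of _ "- _"])
  then interpret A: group ?A .
  have invA: "inv\<^bsub>?A\<^esub> x = - x" for x
    by (rule A.inv_equality) (auto simp: additive_group_of_def)
  have "subgroup L (?A \<times>\<times> H)"
    using cps by (auto simp: cut_and_project_scheme_def lattice_in_def)
  then interpret L: subgroup L "?A \<times>\<times> H" .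
  show pH: "snd p \<in> carrier H" using L.subset p by force
  show "(0, \<one>\<^bsub>H\<^esub>) \<in> L" using L.one_closed by (simp add: additive_group_of_def)
  show "(fst p + fst q, snd p \<otimes>\<^bsub>H\<^esub> snd q) \<in> L"
    using L.m_closed[OF p q] by (simp add: mult_DirProd' additive_group_of_def)
  have "inv\<^bsub>?A \<times>\<times> H\<^esub> (fst p, snd p) = (inv\<^bsub>?A\<^esub> fst p, inv\<^bsub>H\<^esub> snd p)"
    by (rule inv_DirProd[OF A H.is_group]) (use pH in \<open>auto simp: additive_group_of_def\<close>)
  then show "(- fst p, inv\<^bsub>H\<^esub> snd p) \<in> L"
    using L.m_inv_closed[OF p] by (simp add: invA)
qed

text \<open>The sets \<open>U n\<close> in the proof consist of the pairs \<open>(v, h)\<close> for which some lattice point lies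
  within distance \<open>n\<close> of \<open>v\<close> and within \<open>W\<close> of \<open>h\<close>. They are open, invariant under the lattice, and
  increasing; they exhaust the product because the lattice projects densely. Hence they descend to
  an open cover of the compact quotient, and already one \<open>U n\<close> is everything. The lattice points
  found near \<open>(z, 1)\<close> are the desired ones.\<close>

lemma cut_and_project_relatively_dense:
  fixes L :: "((real^'d) \<times> 'h) set"
  assumes cps: "cut_and_project_scheme H T L"
    and W: "openin T W" "\<one>\<^bsub>H\<^esub> \<in> W" and W_inv: "\<And>w. w \<in> W \<Longrightarrow> inv\<^bsub>H\<^esub> w \<in> W"
  shows "\<exists>r. \<forall>z. \<exists>l\<in>L. snd l \<in> W \<and> norm (z - fst l) \<le> r"
proof -
  let ?A = "additive_group_of :: (real^'d) monoid"
  let ?G = "?A \<times>\<times> H"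
  let ?T = "prod_topology euclidean T"
  let ?q = "\<lambda>x. L #>\<^bsub>?G\<^esub> x"
  have lca: "lca_group H T" and dense: "T closure_of (snd ` L) = topspace T"
    and latt: "lattice_in ?G ?T L"
    using cps by (auto simp: cut_and_project_scheme_def)
  have top: "topspace T = carrier H" and grp: "comm_group H"
    using lca by (auto simp: lca_group_def)
  interpret H: comm_group H by (rule grp)
  note sub = cut_and_project_subgroup[OF cps]
  obtain X where X: "quotient_map ?T X ?q" "compact_space X"
    using latt by (auto simp: lattice_in_def)
  define U where "U n = {(v, h). h \<in> carrier H \<and>
      (\<exists>l\<in>L. h \<otimes>\<^bsub>H\<^esub> inv\<^bsub>H\<^esub> snd l \<in> W \<and> norm (v - fst l) < real n)}" for n :: nat
  have U_mono: "U m \<subseteq> U n" if "m \<le> n" for m n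
    using that by (fastforce simp: U_def)
  have U_top: "U n \<subseteq> topspace ?T" for n by (auto simp: U_def top)
  have U_open: "openin ?T (U n)" for n
  proof -
    have "U n = (\<Union>l\<in>L. ball (fst l) (real n) \<times> {h \<in> carrier H. h \<otimes>\<^bsub>H\<^esub> inv\<^bsub>H\<^esub> snd l \<in> W})"
      by (auto simp: U_def dist_norm norm_minus_commute)
    moreover have "openin ?T (ball (fst l) (real n) \<times> {h \<in> carrier H. h \<otimes>\<^bsub>H\<^esub> inv\<^bsub>H\<^esub> snd l \<in> W})"
      if "l \<in> L" for l
      using lca_group_open_translate[OF lca W(1), of "inv\<^bsub>H\<^esub> snd l"] sub(1)[OF that that]
      by (simp add: openin_prod_Times_iff)
    ultimately show ?thesis by auto
  qed
  have U_cover: "topspace ?T \<subseteq> (\<Union>n. U n)"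
  proof clarify
    fix v :: "real^'d" and h assume "(v, h) \<in> topspace ?T"
    then have h: "h \<in> carrier H" by (simp add: top)
    let ?N = "{g \<in> carrier H. g \<otimes>\<^bsub>H\<^esub> inv\<^bsub>H\<^esub> h \<in> W}"
    have N: "h \<in> ?N" "openin T ?N"
      using lca_group_open_translate[OF lca W(1)] h W(2) by simp_all
    have "h \<in> T closure_of (snd ` L)" using dense h top by simp
    then have "\<exists>g\<in>snd ` L. g \<in> ?N" using N by (meson in_closure_of)
    then obtain l where l: "l \<in> L" "snd l \<otimes>\<^bsub>H\<^esub> inv\<^bsub>H\<^esub> h \<in> W"
      by auto
    from W_inv[OF l(2)] have "h \<otimes>\<^bsub>H\<^esub> inv\<^bsub>H\<^esub> snd l \<in> W"
      using sub(1)[OF l(1) l(1)] h H.m_comm[of "inv\<^bsub>H\<^esub> snd l" h] by (simp add: H.inv_mult)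
    moreover obtain n :: nat where "norm (v - fst l) < real n" using reals_Archimedean2 by blast
    ultimately show "(v, h) \<in> (\<Union>n. U n)" using l(1) h by (auto simp: U_def)
  qed
  have U_saturated: "y \<in> U n" if y: "y \<in> topspace ?T" and x: "x \<in> U n" and eq: "?q y = ?q x" for x y n
  proof -
    obtain v h where xv: "x = (v, h)" by fastforce
    obtain v' h' where yv: "y = (v', h')" by fastforce
    have h: "h \<in> carrier H" "h' \<in> carrier H" using x y by (auto simp: U_def xv yv top)
    obtain l where l: "l \<in> L" "h \<otimes>\<^bsub>H\<^esub> inv\<^bsub>H\<^esub> snd l \<in> W" "norm (v - fst l) < real n"
      using x by (auto simp: U_def xv)
    have "y \<in> ?q y"
      unfolding r_coset_def using sub(2)[OF l(1) l(1)] h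
      by (auto simp: yv additive_group_of_def intro!: bexI[of _ "(0, \<one>\<^bsub>H\<^esub>)"])
    then have "y \<in> ?q x" by (simp only: eq)
    then obtain l' where l': "l' \<in> L" "v' = fst l' + v" "h' = snd l' \<otimes>\<^bsub>H\<^esub> h"
      unfolding r_coset_def by (auto simp: xv yv mult_DirProd' additive_group_of_def)
    let ?l = "(fst l' + fst l, snd l' \<otimes>\<^bsub>H\<^esub> snd l)"
    have lc: "snd l \<in> carrier H" "snd l' \<in> carrier H" using sub(1) l(1) l'(1) by auto
    have "h' \<otimes>\<^bsub>H\<^esub> inv\<^bsub>H\<^esub> (snd l' \<otimes>\<^bsub>H\<^esub> snd l) = h \<otimes>\<^bsub>H\<^esub> inv\<^bsub>H\<^esub> snd l"
    proof -
      have eq1: "h' \<otimes>\<^bsub>H\<^esub> inv\<^bsub>H\<^esub> (snd l' \<otimes>\<^bsub>H\<^esub> snd l)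
          = (h \<otimes>\<^bsub>H\<^esub> snd l') \<otimes>\<^bsub>H\<^esub> (inv\<^bsub>H\<^esub> snd l' \<otimes>\<^bsub>H\<^esub> inv\<^bsub>H\<^esub> snd l)"
        using lc h by (simp add: l'(3) H.inv_mult H.m_comm)
      have "snd l' \<otimes>\<^bsub>H\<^esub> (inv\<^bsub>H\<^esub> snd l' \<otimes>\<^bsub>H\<^esub> inv\<^bsub>H\<^esub> snd l) = inv\<^bsub>H\<^esub> snd l"
        using lc by (simp add: H.m_assoc[symmetric])
      then have "(h \<otimes>\<^bsub>H\<^esub> snd l') \<otimes>\<^bsub>H\<^esub> (inv\<^bsub>H\<^esub> snd l' \<otimes>\<^bsub>H\<^esub> inv\<^bsub>H\<^esub> snd l) = h \<otimes>\<^bsub>H\<^esub> inv\<^bsub>H\<^esub> snd l"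
        using lc h by (simp add: H.m_assoc)
      with eq1 show ?thesis by simp
    qed
    with l sub(3)[OF l'(1) l(1)] h show ?thesis
      by (auto simp: U_def yv l'(2) intro!: bexI[of _ ?l])
  qed
  have onto: "?q ` topspace ?T = topspace X"
    and q_open: "\<And>S. S \<subseteq> topspace X \<Longrightarrow> openin ?T {x \<in> topspace ?T. ?q x \<in> S} \<longleftrightarrow> openin X S"
    using X(1) by (auto simp: quotient_map_def)
  have "openin X (?q ` U n)" for n
  proof -
    have "{x \<in> topspace ?T. ?q x \<in> ?q ` U n} = U n"
      using U_saturated U_top by blast
    moreover have "?q ` U n \<subseteq> topspace X" unfolding onto[symmetric] using U_top[of n] by (rule image_mono)
    ultimately show ?thesis using q_open[of "?q ` U n"] U_open[of n] by (simp only:)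
  qed
  moreover have "topspace X \<subseteq> (\<Union>n. ?q ` U n)"
  proof
    fix c assume "c \<in> topspace X"
    then obtain x where "x \<in> topspace ?T" "c = ?q x" using onto by blast
    with U_cover show "c \<in> (\<Union>n. ?q ` U n)" by blast
  qed
  ultimately obtain \<F> where F: "finite \<F>" "\<F> \<subseteq> range (\<lambda>n. ?q ` U n)" "topspace X \<subseteq> \<Union>\<F>"
    using X(2) unfolding compact_space_alt by (metis (no_types, lifting) rangeE)
  then obtain N where N: "finite N" "\<F> = (\<lambda>n. ?q ` U n) ` N"
    by (meson finite_subset_image)
  define M where "M = Max (insert 0 N)"
  have M: "x \<in> U M" if "x \<in> topspace ?T" for x
  proof -
    have "?q x \<in> topspace X" using onto that by blast
    then obtain n where "n \<in> N" "?q x \<in> ?q ` U n" using F(3) N(2) by auto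
    then have "x \<in> U n" using U_saturated that by blast
    moreover have "n \<le> M" using \<open>n \<in> N\<close> N(1) by (simp add: M_def)
    ultimately show ?thesis using U_mono by blast
  qed
  have "\<exists>l\<in>L. snd l \<in> W \<and> norm (z - fst l) \<le> real M" for z
  proof -
    have "(z, \<one>\<^bsub>H\<^esub>) \<in> U M" using M by (simp add: top)
    then obtain l where l: "l \<in> L" "\<one>\<^bsub>H\<^esub> \<otimes>\<^bsub>H\<^esub> inv\<^bsub>H\<^esub> snd l \<in> W" "norm (z - fst l) < real M"
      by (auto simp: U_def)
    then show ?thesis using W_inv[OF l(2)] sub(1)[OF l(1) l(1)] by (auto intro!: bexI[of _ l])
  qed
  then show ?thesis by blast
qed

text \<open>The set \<open>B\<close> is the model set of a small symmetric neighbourhood of the identity, and \<open>x\<close> lies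
  over the interior of the window: steps in \<open>B\<close> move the internal coordinate of \<open>x\<close> so little that
  it stays in the window. This is all that is needed from a model set: a relatively dense set of
  translations that can be combined a few times without leaving \<open>V\<close>.\<close>

lemma model_set_almost_periods:
  fixes V :: "(real^'d) set"
  assumes "model_set TYPE('h) V"
  obtains x B r where "x \<in> V" "0 \<in> B" "\<And>b. b \<in> B \<Longrightarrow> - b \<in> B"
    "\<And>a b c. \<lbrakk>a \<in> B; b \<in> B; c \<in> B\<rbrakk> \<Longrightarrow> x + a + b + c \<in> V"
    "\<And>z. \<exists>b\<in>B. norm (z - b) \<le> r"
proof -
  obtain H :: "'h monoid" and T L \<Omega> t where cps: "cut_and_project_scheme H T L"
    and \<Omega>: "T interior_of \<Omega> \<noteq> {}"
    and V: "V = (+) t ` {fst x |x. x \<in> L \<and> snd x \<in> \<Omega>}"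
    using assms unfolding model_set_def by blast
  have lca: "lca_group H T" and dense: "T closure_of (snd ` L) = topspace T"
    using cps by (auto simp: cut_and_project_scheme_def)
  have "comm_group H" using lca by (auto simp: lca_group_def)
  then interpret H: comm_group H .
  note sub = cut_and_project_subgroup[OF cps]
  obtain u where u: "u \<in> T interior_of \<Omega>" using \<Omega> by blast
  then have "u \<in> T closure_of (snd ` L)"
    using dense interior_of_subset_topspace[of T \<Omega>] by auto
  then have "\<exists>g\<in>snd ` L. g \<in> T interior_of \<Omega>"
    using u openin_interior_of[of T \<Omega>] by (meson in_closure_of)
  then obtain l0 where l0: "l0 \<in> L" "snd l0 \<in> T interior_of \<Omega>"
    by auto
  obtain W where W: "openin T W" "\<one>\<^bsub>H\<^esub> \<in> W" "\<And>w. w \<in> W \<Longrightarrow> inv\<^bsub>H\<^esub> w \<in> W"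
    "\<And>a b c. \<lbrakk>a \<in> W; b \<in> W; c \<in> W\<rbrakk> \<Longrightarrow> snd l0 \<otimes>\<^bsub>H\<^esub> a \<otimes>\<^bsub>H\<^esub> b \<otimes>\<^bsub>H\<^esub> c \<in> T interior_of \<Omega>"
    using lca_group_symmetric_nhd[OF lca openin_interior_of l0(2)] by metis
  define B where "B = {fst l |l. l \<in> L \<and> snd l \<in> W}"
  obtain r where r: "\<And>z. \<exists>l\<in>L. snd l \<in> W \<and> norm (z - fst l) \<le> r"
    using cut_and_project_relatively_dense[OF cps W(1-3)] by auto
  have in_V: "t + fst l \<in> V" if "l \<in> L" "snd l \<in> T interior_of \<Omega>" for l
    using that interior_of_subset[of T \<Omega>] unfolding V by blast
  show thesis
  proof (rule that[of "t + fst l0" B r])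
    show "t + fst l0 \<in> V" using in_V l0 by blast
    show "0 \<in> B" using sub(2)[OF l0(1) l0(1)] W(2) by (force simp: B_def)
    show "- b \<in> B" if b: "b \<in> B" for b
    proof -
      from b obtain l where "l \<in> L" "snd l \<in> W" "b = fst l" by (auto simp: B_def)
      then show ?thesis using sub(4)[of l l] W(3) by (force simp: B_def)
    qed
    show "t + fst l0 + a + b + c \<in> V" if abc: "a \<in> B" "b \<in> B" "c \<in> B" for a b c
    proof -
      obtain p q s where p: "p \<in> L" "snd p \<in> W" "a = fst p" and q: "q \<in> L" "snd q \<in> W" "b = fst q"
        and s: "s \<in> L" "snd s \<in> W" "c = fst s"
        using abc by (auto simp: B_def)
      have "(fst l0 + a + b + c, snd l0 \<otimes>\<^bsub>H\<^esub> snd p \<otimes>\<^bsub>H\<^esub> snd q \<otimes>\<^bsub>H\<^esub> snd s) \<in> L"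
        using sub(3)[OF sub(3)[OF sub(3)[OF l0(1) p(1)] q(1)] s(1)] p q s by simp
      from in_V[OF this] W(4)[OF p(2) q(2) s(2)] show ?thesis by (simp add: add.assoc)
    qed
    show "\<exists>b\<in>B. norm (z - b) \<le> r" for z using r[of z] unfolding B_def by blast
  qed
qed


section \<open>Colorings with an injective substitution rule\<close>

lemma group_closure_subset_subgroup:
  fixes S K :: "'a::ab_group_add set"
  assumes "S \<subseteq> K" "0 \<in> K" "\<And>x y. \<lbrakk>x \<in> K; y \<in> K\<rbrakk> \<Longrightarrow> x - y \<in> K"
  shows "group_closure S \<subseteq> K"
proof
  fix x assume "x \<in> group_closure S"
  then show "x \<in> K" by induction (use assms in auto)
qed

text \<open>These are the translation parts of \<open>n\<close>-fold compositions of maps \<open>x \<mapsto> Q x + d\<close> with \<open>d \<in> D\<close>,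
  that is, the numbers with \<open>n\<close> digits in the numeration system with base \<open>Q\<close>.\<close>

primrec digit_sums :: "('a \<Rightarrow> 'a) \<Rightarrow> 'a::ab_group_add set \<Rightarrow> nat \<Rightarrow> 'a set"
  where
    "digit_sums Q D 0 = {0}"
  | "digit_sums Q D (Suc n) = (\<Union>e\<in>digit_sums Q D n. (\<lambda>d. Q e + d) ` D)"

definition color_module :: "'a::ab_group_add set \<Rightarrow> ('a \<Rightarrow> 'c) \<Rightarrow> 'a set"
  where "color_module L col = group_closure {x - y |x y. x \<in> L \<and> y \<in> L \<and> col x = col y}"

text \<open>Coloring each point of \<open>L\<close> by its type turns a lattice substitution system into a rule by which
  \<open>col x\<close> and \<open>d\<close> determine \<open>col (Q x + d)\<close> (\<open>col_Q\<close>). The absence of pairwise coincidences is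
  the statement that, within one coset of the module of color differences, this rule is injective
  in the color (\<open>col_Q_inj\<close>). Legality of all clusters enters as \<open>patch_digits\<close>: every
  patch of \<open>L\<close> can be translated into the set of digit sums of some length.\<close>

locale coincidence_free_coloring =
  fixes Q :: "'a::real_normed_vector \<Rightarrow> 'a" and L D :: "'a set" and col :: "'a \<Rightarrow> 'c::finite"
  assumes Q_diff: "Q (x - y) = Q x - Q y"
    and zero_L: "0 \<in> L"
    and diff_L: "\<lbrakk>x \<in> L; y \<in> L\<rbrakk> \<Longrightarrow> x - y \<in> L"
    and Q_L: "x \<in> L \<Longrightarrow> Q x \<in> L"
    and D_L: "D \<subseteq> L"
    and zero_D: "0 \<in> D"
    and L_cover: "z \<in> L \<Longrightarrow> \<exists>y\<in>L. \<exists>d\<in>D. z = Q y + d"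
    and col_Q: "\<lbrakk>x \<in> L; y \<in> L; d \<in> D; col x = col y\<rbrakk> \<Longrightarrow> col (Q x + d) = col (Q y + d)"
    and col_Q_inj: "\<lbrakk>x \<in> L; y \<in> L; x - y \<in> color_module L col; d \<in> D;
      col (Q x + d) = col (Q y + d)\<rbrakk> \<Longrightarrow> col x = col y"
    and finite_L: "finite (L \<inter> cball 0 r)"
    and patch_digits: "\<exists>k w. \<forall>f\<in>L \<inter> cball 0 r. w + f \<in> digit_sums Q D k"
begin

abbreviation "L' \<equiv> color_module L col"

lemma Q_zero: "Q 0 = 0" using Q_diff[of 0 0] by simp
lemma Q_add: "Q (x + y) = Q x + Q y"
  using Q_diff[of x "- y"] Q_diff[of 0 y] by (simp add: Q_zero)

lemma Qn_diff: "(Q ^^ n) (x - y) = (Q ^^ n) x - (Q ^^ n) y"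
  by (induction n) (auto simp: Q_diff)

lemma Qn_add: "(Q ^^ n) (x + y) = (Q ^^ n) x + (Q ^^ n) y"
  by (induction n) (auto simp: Q_add)

lemma add_L: "\<lbrakk>x \<in> L; y \<in> L\<rbrakk> \<Longrightarrow> x + y \<in> L"
  using diff_L[of x "0 - y"] diff_L[OF zero_L, of y] by simp

lemma Qn_L: "x \<in> L \<Longrightarrow> (Q ^^ n) x \<in> L"
  by (induction n) (auto simp: Q_L)

lemma digit_sums_L: "digit_sums Q D n \<subseteq> L"
proof (induction n)
  case (Suc n)
  have "Q e + d \<in> L" if "e \<in> digit_sums Q D n" "d \<in> D" for e d
    using Suc that Q_L D_L by (intro add_L) auto
  then show ?case by auto
qed (simp add: zero_L)

text \<open>Since \<open>0\<close> is a digit, leading zeros can be prepended.\<close>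

lemma digit_sums_mono:
  assumes "m \<le> n" shows "digit_sums Q D m \<subseteq> digit_sums Q D n"
proof -
  have "digit_sums Q D n \<subseteq> digit_sums Q D (Suc n)" for n
  proof (induction n)
    case 0
    then show ?case using zero_D by (auto simp: Q_zero)
  next
    case (Suc n)
    have "(\<Union>e\<in>digit_sums Q D n. (\<lambda>d. Q e + d) ` D)
        \<subseteq> (\<Union>e\<in>digit_sums Q D (Suc n). (\<lambda>d. Q e + d) ` D)"
      using Suc by (rule UN_mono) simp
    then show ?case by simp
  qed
  then show ?thesis using assms by (rule lift_Suc_mono_le)
qed

lemma color_module_diff: "\<lbrakk>u \<in> L'; v \<in> L'\<rbrakk> \<Longrightarrow> u - v \<in> L'"
  unfolding color_module_def by (rule group_closure.diff)

lemma same_color_diff: "\<lbrakk>x \<in> L; y \<in> L; col x = col y\<rbrakk> \<Longrightarrow> x - y \<in> L'"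
  unfolding color_module_def by (rule group_closure.base) auto

lemma color_module_L: "L' \<subseteq> L"
  unfolding color_module_def by (rule group_closure_subset_subgroup) (auto simp: zero_L diff_L)

lemma Q_color_module: "u \<in> L' \<Longrightarrow> Q u \<in> L'"
proof -
  have "L' \<subseteq> {u. Q u \<in> L'}"
    unfolding color_module_def
  proof (rule group_closure_subset_subgroup, clarsimp)
    fix x y assume "x \<in> L" "y \<in> L" "col x = col y"
    moreover from this have "col (Q x) = col (Q y)" using col_Q[of x y 0] zero_D by simp
    ultimately show "Q (x - y) \<in> group_closure {x - y |x y. x \<in> L \<and> y \<in> L \<and> col x = col y}"
      using same_color_diff[of "Q x" "Q y"] Q_L by (simp add: Q_diff color_module_def)
  qed (auto simp: Q_zero Q_diff intro: group_closure.diff)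
  then show "u \<in> L' \<Longrightarrow> Q u \<in> L'" by auto
qed

lemma Qn_color_module: "u \<in> L' \<Longrightarrow> (Q ^^ n) u \<in> L'"
  by (induction n) (auto simp: Q_color_module)

lemma col_Qn:
  assumes "x \<in> L" "y \<in> L" "col x = col y" "e \<in> digit_sums Q D n"
  shows "col ((Q ^^ n) x + e) = col ((Q ^^ n) y + e)"
  using assms(4)
proof (induction n arbitrary: e)
  case 0
  then show ?case using assms by simp
next
  case (Suc n)
  then obtain e' d where e: "e' \<in> digit_sums Q D n" "d \<in> D" "e = Q e' + d" by auto
  have "e' \<in> L" using e(1) digit_sums_L by blast
  then have "col (Q ((Q ^^ n) x + e') + d) = col (Q ((Q ^^ n) y + e') + d)"
    by (intro col_Q Suc.IH[OF e(1)] add_L Qn_L assms e(2))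
  then show ?case using e by (simp add: Q_add add.assoc)
qed

lemma col_Qn_inj:
  assumes "x \<in> L" "y \<in> L" "x - y \<in> L'" "e \<in> digit_sums Q D n"
    and "col ((Q ^^ n) x + e) = col ((Q ^^ n) y + e)"
  shows "col x = col y"
  using assms(4,5)
proof (induction n arbitrary: e)
  case 0
  then show ?case by simp
next
  case (Suc n)
  then obtain e' d where e: "e' \<in> digit_sums Q D n" "d \<in> D" "e = Q e' + d" by auto
  have "e' \<in> L" using e(1) digit_sums_L by blast
  moreover have "(Q ^^ n) x + e' - ((Q ^^ n) y + e') \<in> L'"
    using Qn_color_module[OF assms(3), of n] by (simp add: Qn_diff)
  moreover have "col (Q ((Q ^^ n) x + e') + d) = col (Q ((Q ^^ n) y + e') + d)"
    using Suc.prems(2) e by (simp add: Q_add add.assoc)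
  ultimately have "col ((Q ^^ n) x + e') = col ((Q ^^ n) y + e')"
    using col_Q_inj[OF _ _ _ e(2)] add_L Qn_L assms(1,2) by simp
  then show ?case by (rule Suc.IH[OF e(1)])
qed

definition "periods = {u \<in> L. \<forall>y\<in>L. col (y + u) = col y}"

lemma periodsD: "\<lbrakk>u \<in> periods; y \<in> L\<rbrakk> \<Longrightarrow> col (y + u) = col y"
  by (simp add: periods_def)

lemma periods_L: "periods \<subseteq> L"
  by (auto simp: periods_def)

lemma zero_periods: "0 \<in> periods" by (simp add: periods_def zero_L)

lemma periods_diff: assumes u: "u \<in> periods" and v: "v \<in> periods" shows "u - v \<in> periods"
proof -
  have L: "u \<in> L" "v \<in> L" using u v periods_L by auto
  have "col (y + (u - v)) = col y" if y: "y \<in> L" for y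
    using periodsD[OF u, of "y - v"] periodsD[OF v, of "y - v"] diff_L[OF y L(2)]
    by (simp add: algebra_simps)
  then show ?thesis using diff_L[OF L] by (simp add: periods_def)
qed

lemma periods_add: "\<lbrakk>u \<in> periods; v \<in> periods\<rbrakk> \<Longrightarrow> u + v \<in> periods"
  using periods_diff[of u "0 - v"] periods_diff[OF zero_periods, of v] by simp

text \<open>Injectivity of the substitution rule allows division by \<open>Q\<close> inside \<open>L'\<close>.\<close>

lemma Qn_periods_cancel:
  assumes "v \<in> L'" "(Q ^^ n) v \<in> periods"
  shows "v \<in> periods"
proof -
  have vL: "v \<in> L" using assms color_module_L by auto
  have "0 \<in> digit_sums Q D n" using digit_sums_mono[of 0 n] by auto
  moreover have "col ((Q ^^ n) (y + v) + 0) = col ((Q ^^ n) y + 0)" if "y \<in> L" for y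
    using periodsD[OF assms(2) Qn_L[OF that, of n]] Qn_diff[of n "y + v" v] by (simp add: algebra_simps)
  ultimately have "col (y + v) = col y" if "y \<in> L" for y
    using col_Qn_inj[of "y + v" y 0 n] that assms(1) vL add_L by auto
  then show ?thesis using vL by (simp add: periods_def)
qed

lemma Qn_periods:
  assumes u: "u \<in> periods"
  shows "(Q ^^ n) u \<in> periods"
proof (induction n)
  case (Suc n)
  let ?u = "(Q ^^ n) u"
  have "col (z + Q ?u) = col z" if z: "z \<in> L" for z
  proof -
    obtain y d where y: "y \<in> L" "d \<in> D" "z = Q y + d" using L_cover[OF z] by auto
    have "col (Q (y + ?u) + d) = col (Q y + d)"
      using y periodsD[OF Suc y(1)] add_L periods_L Suc by (intro col_Q) auto
    then show ?thesis by (simp add: y Q_add algebra_simps)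
  qed
  then show ?case using Suc periods_L Q_L by (auto simp: periods_def)
qed (simp add: u)

text \<open>Let \<open>v \<in> L'\<close> be such that \<open>Q\<^sup>k v\<close> is a difference of two elements of \<open>B\<close>. Given
  any \<open>y\<close>, there is a digit sum \<open>e\<close> of length \<open>k\<close> that moves \<open>Q\<^sup>k y\<close> into \<open>x + B\<close>; this is so as soon
  as the digit sums of length \<open>k\<close> contain a patch whose radius is the covering radius of \<open>B\<close>. Then
  both \<open>Q\<^sup>k y + e\<close> and \<open>Q\<^sup>k (y + v) + e\<close> have the color of \<open>x\<close>, so \<open>y\<close> and \<open>y + v\<close> have the same
  color by injectivity. Thus \<open>v\<close> is a genuine period, whereas elements of \<open>B\<close> are only known to
  preserve the color of the single point \<open>x\<close>. A pigeonhole argument provides enough such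
  \<open>v\<close> for finite index.\<close>

lemma almost_periods_imp_finite_index:
  assumes B0: "0 \<in> B" and B_uminus: "\<And>b. b \<in> B \<Longrightarrow> - b \<in> B"
    and x: "x \<in> L"
    and x_shift: "\<And>a b c. \<lbrakk>a \<in> B; b \<in> B; c \<in> B\<rbrakk> \<Longrightarrow> x + a + b + c \<in> L \<and> col (x + a + b + c) = col x"
    and B_dense: "\<And>z. \<exists>b\<in>B. norm (z - b) \<le> r"
  obtains F where "finite F" "F \<subseteq> L" "\<And>y. y \<in> L \<Longrightarrow> \<exists>f\<in>F. y - f \<in> periods"
proof -
  have B_L: "b \<in> L" if "b \<in> B" for b
    using x_shift[OF that B0 B0] diff_L[of "x + b" x] x by simp
  define F0 where "F0 = L \<inter> cball 0 r"
  obtain k w where w: "\<And>f. f \<in> F0 \<Longrightarrow> w + f \<in> digit_sums Q D k"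
    using patch_digits[of r] unfolding F0_def by blast
  \<comment> \<open>The covering radius \<open>r\<close> of \<open>B\<close> makes \<open>F0 + B\<close> all of \<open>L\<close>.\<close>
  have decompose: "\<exists>f\<in>F0. \<exists>b\<in>B. z = f + b" if "z \<in> L" for z
  proof -
    obtain b where "b \<in> B" "norm (z - b) \<le> r" using B_dense by blast
    then show ?thesis using that diff_L B_L
      by (intro bexI[of _ "z - b"] bexI[of _ b]) (auto simp: F0_def)
  qed
  have "0 \<in> F0"
    using B_dense[of 0] zero_L order_trans[OF norm_ge_zero] by (auto simp: F0_def)
  then have w_L: "w \<in> L" using w[of 0] digit_sums_L by auto
  have period: "v \<in> periods" if v: "v \<in> L'" and b: "b \<in> B" "b' \<in> B" "(Q ^^ k) v = b - b'" for v b b'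
  proof -
    have vL: "v \<in> L" using v color_module_L by auto
    have "col (y + v) = col y" if y: "y \<in> L" for y
    proof -
      have "x - w - (Q ^^ k) y \<in> L" using x w_L y Qn_L diff_L by auto
      then obtain f c where fc: "f \<in> F0" "c \<in> B" "x - w - (Q ^^ k) y = f + c"
        using decompose by blast
      have e1: "(Q ^^ k) y + (w + f) = x + - c + 0 + 0"
        using fc(3) by (simp add: algebra_simps)
      have "(Q ^^ k) (y + v) + (w + f) = ((Q ^^ k) y + (w + f)) + b + - b'"
        by (simp add: Qn_add b(3))
      then have e2: "(Q ^^ k) (y + v) + (w + f) = x + - c + b + - b'"
        by (simp add: e1)
      have "col ((Q ^^ k) (y + v) + (w + f)) = col x"
        unfolding e2 using x_shift[of "- c" b "- b'"] B_uminus b fc(2) by blast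
      moreover have "col ((Q ^^ k) y + (w + f)) = col x"
        unfolding e1 using x_shift[of "- c" 0 0] B_uminus B0 fc(2) by blast
      ultimately have eq: "col ((Q ^^ k) (y + v) + (w + f)) = col ((Q ^^ k) y + (w + f))" by simp
      have "y + v - y \<in> L'" using v by simp
      from col_Qn_inj[OF add_L[OF y vL] y this w[OF fc(1)] eq] show ?thesis .
    qed
    then show ?thesis using vL by (simp add: periods_def)
  qed
  have "\<exists>f. \<forall>y\<in>L. f y \<in> F0 \<and> (\<exists>b\<in>B. (Q ^^ k) y = f y + b)"
    using decompose Qn_L by (intro bchoice) blast
  then obtain f where f: "\<And>y. y \<in> L \<Longrightarrow> f y \<in> F0 \<and> (\<exists>b\<in>B. (Q ^^ k) y = f y + b)"
    by blast
  \<comment> \<open>The color is recorded as well, so that points with the same value differ by an element of \<open>L'\<close>.\<close>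
  define g where "g y = (f y, col y)" for y
  have "g ` L \<subseteq> F0 \<times> UNIV" using f by (auto simp: g_def)
  moreover have "finite (F0 \<times> (UNIV :: 'c set))" using finite_L by (simp add: F0_def)
  ultimately have fin: "finite (g ` L)" by (rule finite_subset)
  show thesis
  proof (rule that[of "inv_into L g ` g ` L"])
    show "finite (inv_into L g ` g ` L)" using fin by blast
    show "inv_into L g ` g ` L \<subseteq> L" by (auto intro: inv_into_into)
    fix y assume y: "y \<in> L"
    let ?y' = "inv_into L g (g y)"
    have y': "?y' \<in> L" "g ?y' = g y" using y by (auto intro: inv_into_into f_inv_into_f)
    obtain b b' where b: "b \<in> B" "(Q ^^ k) y = f y + b" "b' \<in> B" "(Q ^^ k) ?y' = f ?y' + b'"
      using f y y' by blast
    have "y - ?y' \<in> L'" using y y' by (intro same_color_diff) (auto simp: g_def)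
    moreover have "(Q ^^ k) (y - ?y') = b - b'"
      using b y'(2) by (simp add: Qn_diff g_def)
    ultimately have "y - ?y' \<in> periods" using b period by blast
    then show "\<exists>f\<in>inv_into L g ` g ` L. y - f \<in> periods" using y by blast
  qed
qed

text \<open>If the periods have finite index, then \<open>Q\<close>, being injective on \<open>L'\<close> modulo periods, returns
  every element of \<open>L'\<close> to its class after finitely many steps. Let \<open>u\<close> be the difference of two points
  \<open>x\<close> and \<open>y\<close> of the same color. For suitable large \<open>N\<close>, the equality of the colors of
  \<open>Q\<^sup>N x + e\<close> and \<open>Q\<^sup>N y + e\<close> then says that translation by \<open>u\<close> preserves the color of \<open>Q\<^sup>N y + e\<close>. The
  digit sums \<open>e\<close> meet all classes modulo periods, so \<open>u\<close> is a period.\<close>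

lemma finite_index_imp_color_module_periods:
  assumes F: "finite F" "F \<subseteq> L" "\<And>y. y \<in> L \<Longrightarrow> \<exists>f\<in>F. y - f \<in> periods"
  shows "L' \<subseteq> periods"
  unfolding color_module_def
proof (rule group_closure_subset_subgroup, clarsimp)
  fix x y assume xy: "x \<in> L" "y \<in> L" "col x = col y"
  define u where "u = x - y"
  have u: "u \<in> L'" "u \<in> L" using xy same_color_diff diff_L by (auto simp: u_def)
  \<comment> \<open>Two powers of \<open>Q\<close> agree on \<open>u\<close> modulo periods, and the smaller power can be cancelled.\<close>
  obtain p where p: "p > 0" "(Q ^^ p) u - u \<in> periods"
  proof -
    have "\<exists>f. \<forall>n. f n \<in> F \<and> (Q ^^ n) u - f n \<in> periods"
      using F(3) Qn_L[OF u(2)] by (intro choice) blast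
    then obtain f where f: "\<And>n. f n \<in> F" "\<And>n. (Q ^^ n) u - f n \<in> periods" by blast
    have "finite (range f)" using f(1) F(1) finite_subset by (metis image_subsetI)
    then have "\<not> inj f" using finite_imageD infinite_UNIV_nat by blast
    then obtain m n where mn: "m < n" "f m = f n"
      by (metis inj_on_def linorder_neqE_nat)
    have n: "n = m + (n - m)" using mn by simp
    have "(Q ^^ m) ((Q ^^ (n - m)) u - u) = (Q ^^ n) u - (Q ^^ m) u"
      by (subst (2) n) (simp only: funpow_add Qn_diff o_apply)
    also have "\<dots> \<in> periods" using periods_diff[OF f(2)[of n] f(2)[of m]] mn(2) by simp
    finally have "(Q ^^ (n - m)) u - u \<in> periods"
      using Qn_periods_cancel color_module_diff Qn_color_module u(1) by blast
    then show thesis using mn(1) by (intro that[of "n - m"]) simp_all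
  qed
  have p_mult: "(Q ^^ (p * j)) u - u \<in> periods" for j
  proof (induction j)
    case (Suc j)
    have "(Q ^^ (p * Suc j)) u - u = (Q ^^ p) ((Q ^^ (p * j)) u - u) + ((Q ^^ p) u - u)"
      by (simp add: Qn_diff funpow_add)
    then show ?case using periods_add[OF Qn_periods[OF Suc] p(2)] by (simp only:)
  qed (simp add: zero_periods)
  obtain r where r: "F \<subseteq> cball 0 r"
    using finite_imp_bounded[OF F(1)] unfolding bounded_any_center[of F 0] subset_eq mem_cball
    by blast
  obtain k w where "\<And>f. f \<in> L \<inter> cball 0 r \<Longrightarrow> w + f \<in> digit_sums Q D k"
    using patch_digits[of r] by blast
  \<comment> \<open>A multiple of \<open>p\<close> that is large enough for the digit sums to contain the patch.\<close>
  moreover define N where "N = p * k"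
  moreover have "k \<le> N" using p(1) by (simp add: N_def)
  ultimately have w: "\<And>f. f \<in> F \<Longrightarrow> w + f \<in> digit_sums Q D N"
    using r F(2) digit_sums_mono[of k N] by blast
  obtain f0 where "f0 \<in> F" using F(3)[OF zero_L] by blast
  then have wL: "w \<in> L" using w[of f0] digit_sums_L F(2) diff_L[of "w + f0" f0] by auto
  have "col (z + u) = col z" if z: "z \<in> L" for z
  proof -
    have "z - (Q ^^ N) y - w \<in> L" using z xy wL Qn_L diff_L by auto
    then obtain f where f: "f \<in> F" "z - (Q ^^ N) y - w - f \<in> periods" using F(3) by blast
    define q where "q = z - (Q ^^ N) y - w - f"
    define e where "e = w + f"
    have e: "e \<in> digit_sums Q D N" using w[OF f(1)] by (simp add: e_def)
    then have eL: "e \<in> L" using digit_sums_L by blast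
    have z_eq: "z = ((Q ^^ N) y + e) + q" by (simp add: q_def e_def algebra_simps)
    have q: "q \<in> periods" using f by (simp add: q_def)
    have QN: "(Q ^^ N) u - u \<in> periods" using p_mult by (simp add: N_def)
    have y1: "(Q ^^ N) y + e \<in> L" using xy eL Qn_L add_L by auto
    have "col (z + u) = col (((Q ^^ N) y + e + u) + q)" by (simp add: z_eq algebra_simps)
    also have "\<dots> = col ((Q ^^ N) y + e + u)" using q y1 u add_L by (intro periodsD) auto
    also have "\<dots> = col (((Q ^^ N) y + e + u) + ((Q ^^ N) u - u))"
      using QN y1 u add_L by (intro periodsD[symmetric]) auto
    also have "\<dots> = col ((Q ^^ N) x + e)" by (simp add: u_def Qn_diff algebra_simps)
    also have "\<dots> = col ((Q ^^ N) y + e)" using xy e by (intro col_Qn)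
    also have "\<dots> = col z" unfolding z_eq using q y1 by (intro periodsD[symmetric])
    finally show ?thesis .
  qed
  then show "x - y \<in> periods" using u(2) by (simp add: periods_def u_def)
qed (auto simp: zero_periods periods_diff)

end


section \<open>Lattice substitution systems as colorings\<close>

lemma lattice_in_euclidean:
  fixes L :: "(real^'d) set"
  assumes "lattice_in additive_group_of euclidean L"
  shows "0 \<in> L" "\<And>x y. \<lbrakk>x \<in> L; y \<in> L\<rbrakk> \<Longrightarrow> x - y \<in> L" "finite (L \<inter> cball 0 r)"
proof -
  let ?A = "additive_group_of :: (real^'d) monoid"
  have "group ?A"
    by (rule groupI) (auto simp: additive_group_of_def add.assoc intro: exI[of _ "- _"])
  then interpret A: group ?A .
  have inv_A: "inv\<^bsub>?A\<^esub> x = - x" for x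
    by (rule A.inv_equality) (auto simp: additive_group_of_def)
  have "subgroup L ?A" using assms by (simp add: lattice_in_def)
  then interpret L: subgroup L ?A .
  show zero: "0 \<in> L" using L.one_closed by (simp add: additive_group_of_def)
  show diff: "x - y \<in> L" if "x \<in> L" "y \<in> L" for x y
    using L.m_closed[OF that(1) L.m_inv_closed[OF that(2)]]
    by (simp add: inv_A) (simp add: additive_group_of_def)
  have "openin (top_of_set L) {0}"
    using assms zero by (simp add: lattice_in_def)
  then obtain T where T: "open T" "L \<inter> T = {0}" by (auto simp: openin_open)
  then obtain \<epsilon> where \<epsilon>: "\<epsilon> > 0" "ball 0 \<epsilon> \<subseteq> T" by (metis IntD2 singletonI openE)
  have separated: "y = x" if "x \<in> L" "y \<in> L" "dist y x < \<epsilon>" for x y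
  proof -
    have "y - x \<in> ball 0 \<epsilon>" using that(3) by (simp add: dist_norm norm_minus_commute)
    then have "y - x \<in> L \<inter> T" using diff[OF that(2,1)] \<epsilon>(2) by blast
    then show ?thesis by (simp add: T(2))
  qed
  have "\<not> x islimpt L" for x
    by (rule discrete_imp_not_islimpt[OF \<epsilon>(1) separated])
  then show "finite (L \<inter> cball 0 r)"
    using finite_not_islimpt_in_compact[of "cball 0 r" L] by (simp add: Int_commute)
qed

text \<open>A vector in the kernel would be an eigenvector for the eigenvalue \<open>0\<close>.\<close>

lemma expansive_imp_inj:
  fixes Q :: "real^'d \<Rightarrow> real^'d"
  assumes "expansive Q"
  shows "inj Q"
proof -
  have lin: "linear Q" using assms by (simp add: expansive_def)
  have "v = 0" if "Q v = 0" for v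
  proof (rule ccontr)
    assume v: "v \<noteq> 0"
    define w where "w = (\<chi> i. complex_of_real (v $ i))"
    have "w \<noteq> 0" using v by (auto simp: w_def vec_eq_iff)
    moreover have "map_matrix complex_of_real (matrix Q) *v w = 0 *s w"
    proof -
      have "matrix Q *v v = 0" using that matrix_works[OF lin[folded linear_matrix_vector_mul_eq]] by simp
      then have "(\<Sum>j\<in>UNIV. matrix Q $ i $ j * v $ j) = 0" for i
        by (simp add: vec_eq_iff matrix_vector_mult_def)
      then have "(\<Sum>j\<in>UNIV. complex_of_real (matrix Q $ i $ j) * complex_of_real (v $ j)) = 0" for i
        by (simp flip: of_real_mult of_real_sum)
      then show ?thesis by (simp add: vec_eq_iff matrix_vector_mult_def w_def map_matrix_def)
    qed
    ultimately have "1 < cmod 0" using assms unfolding expansive_def by blast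
    then show False by simp
  qed
  then show ?thesis using linear_injective_0[OF lin] by blast
qed

text \<open>A zero column would persist in all powers.\<close>

lemma primitive_matrix_column_nonzero:
  assumes "primitive_matrix A"
  shows "\<exists>i. A $ i $ j > 0"
proof -
  have "\<exists>i. A $ i $ j > 0" if "(((**) A ^^ Suc k) (mat 1)) $ i $ j > 0" for k i
    using that
  proof (induction k arbitrary: i)
    case 0
    then have "A $ i $ j > 0"
      by (simp only: funpow.simps o_apply id_apply matrix_mul_rid)
    then show ?case by blast
  next
    case (Suc k)
    have "\<exists>l. B $ l $ j > 0" if "(A ** B) $ i $ j > 0" for B
    proof (rule ccontr)
      assume "\<not> ?thesis"
      then have "(A ** B) $ i $ j = 0" by (simp add: matrix_matrix_mult_def)
      then show False using that by simp
    qed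
    moreover have "(A ** (((**) A ^^ Suc k) (mat 1))) $ i $ j > 0"
      using Suc.prems by (simp only: funpow.simps o_apply)
    ultimately have "\<exists>l. (((**) A ^^ Suc k) (mat 1)) $ l $ j > 0" by blast
    then show ?case using Suc.IH by blast
  qed
  then show ?thesis using assms unfolding primitive_matrix_def by (metis gr0_conv_Suc)
qed

text \<open>The recursive equation of \<open>digit_sums\<close> appends a digit at the lowest position; in a power of a
  matrix function system a new digit appears at the highest position.\<close>

lemma digit_sums_Suc_leading:
  assumes "linear Q" "e \<in> digit_sums Q D n" "d \<in> D"
  shows "(Q ^^ n) d + e \<in> digit_sums Q D (Suc n)"
  using assms(2,3)
proof (induction n arbitrary: e)
  case 0
  then show ?case using linear_0[OF assms(1)] by auto
next
  case (Suc n)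
  then obtain e' d' where e: "e' \<in> digit_sums Q D n" "d' \<in> D" "e = Q e' + d'" by auto
  have "(Q ^^ Suc n) d + e = Q ((Q ^^ n) d + e') + d'"
    by (simp add: e linear_add[OF assms(1)])
  then show ?case using Suc.IH[OF e(1) Suc.prems(2)] e(2) by (subst digit_sums.simps(2)) blast
qed

lemma mfs_power_digit_sums:
  assumes lin: "linear Q" and maps: "\<And>i j f. f \<in> \<Phi> i j \<Longrightarrow> \<exists>a\<in>D. f = (\<lambda>x. Q x + a)"
    and g: "g \<in> mfs_power \<Phi> k i j"
  shows "\<exists>e\<in>digit_sums Q D k. g = (\<lambda>x. (Q ^^ k) x + e)"
  using g
proof (induction k arbitrary: g j)
  case 0
  then show ?case by (auto split: if_splits)
next
  case (Suc k)
  then obtain l g' f where gf: "g' \<in> mfs_power \<Phi> k i l" "f \<in> \<Phi> l j" "g = g' \<circ> f" by auto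
  obtain e where e: "e \<in> digit_sums Q D k" "g' = (\<lambda>x. (Q ^^ k) x + e)" using Suc.IH[OF gf(1)] by blast
  obtain d where d: "d \<in> D" "f = (\<lambda>x. Q x + d)" using maps[OF gf(2)] by blast
  have "g = (\<lambda>x. (Q ^^ Suc k) x + ((Q ^^ k) d + e))"
  proof
    fix x
    have "(Q ^^ k) (Q x + d) = (Q ^^ k) (Q x) + (Q ^^ k) d"
      by (induction k) (auto simp: linear_add[OF lin])
    then show "g x = (Q ^^ Suc k) x + ((Q ^^ k) d + e)"
      by (simp add: gf(3) e(2) d(2) funpow_swap1 add.assoc)
  qed
  then show ?case using digit_sums_Suc_leading[OF lin e(1) d(1)] by blast
qed

text \<open>A sum of the subgroups generated by the difference sets is the subgroup generated by all of them
  together.\<close>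

lemma diff_module_eq_color_module:
  assumes col: "\<And>x i. x \<in> supp V \<Longrightarrow> col x = i \<longleftrightarrow> x \<in> V i"
  shows "diff_module V = color_module (supp V) col"
proof
  have V_supp: "V i \<subseteq> supp V" for i by (auto simp: supp_def)
  let ?G = "\<lambda>i. group_closure {x - y |x y. x \<in> V i \<and> y \<in> V i}"
  have diff_module: "diff_module V = {sum s UNIV |s. \<forall>i\<in>UNIV. s i \<in> ?G i}"
    unfolding diff_module_def by (rule set_sum_alt) simp
  have add: "u + v \<in> color_module (supp V) col"
    if "u \<in> color_module (supp V) col" "v \<in> color_module (supp V) col" for u v
    using that unfolding color_module_def by (rule group_closure_add)
  have G: "?G i \<subseteq> color_module (supp V) col" for i
  proof (rule group_closure_subset_subgroup)
    show "{x - y |x y. x \<in> V i \<and> y \<in> V i} \<subseteq> color_module (supp V) col"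
    proof clarify
      fix x y assume "x \<in> V i" "y \<in> V i"
      moreover from this have "x \<in> supp V" "y \<in> supp V" using V_supp by auto
      ultimately have "x \<in> supp V \<and> y \<in> supp V \<and> col x = col y" using col by metis
      then show "x - y \<in> color_module (supp V) col"
        unfolding color_module_def by (intro group_closure.base insertI2) blast
    qed
  qed (auto simp: color_module_def intro: group_closure.diff)
  show "diff_module V \<subseteq> color_module (supp V) col"
  proof
    fix u assume "u \<in> diff_module V"
    then obtain s where s: "u = sum s UNIV" "\<And>i. s i \<in> ?G i" by (auto simp: diff_module)
    have "sum s I \<in> color_module (supp V) col" if "finite I" for I
      using that
    proof induction
      case empty
      then show ?case by (simp add: color_module_def)
    next
      case (insert i I)
      have "s i \<in> color_module (supp V) col" using G s(2) by blast
      then show ?case using add insert by simp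
    qed
    then show "u \<in> color_module (supp V) col" by (simp add: s)
  qed
  show "color_module (supp V) col \<subseteq> diff_module V"
    unfolding color_module_def
  proof (rule group_closure_subset_subgroup)
    show "0 \<in> diff_module V"
      unfolding diff_module by (auto intro!: exI[of _ "\<lambda>_. 0"])
    show "u - v \<in> diff_module V" if "u \<in> diff_module V" "v \<in> diff_module V" for u v
    proof -
      from that obtain s t where "u = sum s UNIV" "v = sum t UNIV" "\<And>i. s i \<in> ?G i" "\<And>i. t i \<in> ?G i"
        unfolding diff_module by blast
      then show ?thesis unfolding diff_module
        by (auto intro!: exI[of _ "\<lambda>i. s i - t i"] group_closure.diff simp: sum_subtractf)
    qed
    show "{x - y |x y. x \<in> supp V \<and> y \<in> supp V \<and> col x = col y} \<subseteq> diff_module V"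
    proof clarify
      fix x y assume xy: "x \<in> supp V" "y \<in> supp V" "col x = col y"
      define s where "s i = (if i = col x then x - y else 0)" for i
      have "x \<in> V (col x)" "y \<in> V (col x)"
        using xy(1,2) col xy(3)[symmetric] by blast+
      then have "x - y \<in> ?G (col x)" unfolding xy(3)[symmetric]
        by (intro group_closure.base) blast
      then have "s i \<in> ?G i" for i
        by (cases "i = col x") (simp_all add: s_def)
      moreover have "x - y = sum s UNIV" by (simp add: s_def)
      ultimately show "x - y \<in> diff_module V" unfolding diff_module by blast
    qed
  qed
qed


section \<open>Existence of a pairwise coincidence\<close>

theorem corollary4p7:
  fixes Q :: "(real^'d) \<Rightarrow> (real^'d)"
    and V :: "'m::finite \<Rightarrow> (real^'d) set"
    and \<Phi> :: "('d, 'm) map_sets"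
  assumes "admissible_primitive_lss Q V \<Phi>"
    and "clusters_legal V \<Phi>"
    and "\<forall>a\<in>supp V. \<not> is_singleton (Psi0 V a)"
    and "\<forall>i. model_set TYPE('h) (V i)"
  shows "\<exists>j k. j \<noteq> k \<and>
    (\<exists>a\<in>supp V. j \<in> Psi0 V a \<and> k \<in> Psi0 V a \<and> (\<exists>i. \<Phi> i j \<inter> \<Phi> i k \<noteq> {}))"
proof (rule ccontr)
  assume no_coincidence: "\<not> ?thesis"
  define L where "L = supp V"
  define col where "col x = (THE i. x \<in> V i)" for x
  have lss: "lss Q V \<Phi>" and prim: "primitive_matrix (subst_matrix \<Phi>)"
    using assms(1) by (auto simp: admissible_primitive_lss_def)
  obtain D where D: "representatives Q L D" "0 \<in> D"
    and maps: "\<And>i j f. f \<in> \<Phi> i j \<Longrightarrow> \<exists>a\<in>D. f = (\<lambda>x. Q x + a)"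
    using assms(1) unfolding admissible_primitive_lss_def L_def by blast
  have exp: "expansive Q" and VV: "mfs_apply \<Phi> V = V" and disj: "disjoint_family V"
    and latt: "lattice_in additive_group_of euclidean L"
    using lss by (auto simp: lss_def mfs_def L_def)
  have lin: "linear Q" using exp by (simp add: expansive_def)
  have inj: "inj Q" by (rule expansive_imp_inj[OF exp])
  note L = lattice_in_euclidean[OF latt]
  have L_add: "x + y \<in> L" if "x \<in> L" "y \<in> L" for x y
    using L(2)[OF that(1) L(2)[OF L(1) that(2)]] by simp
  have D_L: "D \<subseteq> L" and D_unique: "\<And>x. x \<in> L \<Longrightarrow> \<exists>!d. d \<in> D \<and> x - d \<in> Q ` L"
    using D(1) by (auto simp: representatives_def)
  have col_iff: "col x = i \<longleftrightarrow> x \<in> V i" if "x \<in> L" for x i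
  proof -
    obtain j where j: "x \<in> V j" using \<open>x \<in> L\<close> by (auto simp: L_def supp_def)
    have only: "i = j" if "x \<in> V i" for i
      using disj j that unfolding disjoint_family_on_def by blast
    have "col x = j" unfolding col_def using j only by (rule the_equality)
    then show ?thesis using j only[of i] by blast
  qed
  have V_L: "x \<in> L" if "x \<in> V i" for x i using that by (auto simp: L_def supp_def)
  have map_V: "f x \<in> V i" if "f \<in> \<Phi> i j" "x \<in> V j" for f i j x
  proof -
    have "f x \<in> mfs_apply \<Phi> V i" using that unfolding mfs_apply_def by blast
    then show ?thesis by (simp add: VV)
  qed
  \<comment> \<open>Every type occurs as the source of some map, so every point of \<open>L\<close> has an image in \<open>L\<close>.\<close>
  have Q_L: "Q x \<in> L" if "x \<in> L" for x
  proof -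
    obtain i where "card (\<Phi> i (col x)) > 0"
      using primitive_matrix_column_nonzero[OF prim, of "col x"] by (auto simp: subst_matrix_def)
    then obtain f where f: "f \<in> \<Phi> i (col x)" by (metis card.empty ex_in_conv less_irrefl)
    then obtain a where a: "a \<in> D" "f = (\<lambda>x. Q x + a)" using maps by blast
    have "Q x + a \<in> L" using map_V[OF f] a(2) col_iff[OF that] V_L by blast
    then show ?thesis using L(2)[of "Q x + a" a] a(1) D_L by auto
  qed
  \<comment> \<open>The point \<open>Q y + d\<close> determines its digit \<open>d\<close> and its predecessor \<open>y\<close>, so the map that produces it
    within the substitution must be \<open>x \<mapsto> Q x + d\<close>, applied to the type of \<open>y\<close>.\<close>
  have map_in_\<Phi>: "(\<lambda>x. Q x + d) \<in> \<Phi> (col (Q y + d)) (col y)" if y: "y \<in> L" and d: "d \<in> D" for y d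
  proof -
    have yd: "Q y + d \<in> L" using Q_L[OF y] D_L d L_add by auto
    then have "Q y + d \<in> V (col (Q y + d))" using col_iff by blast
    then have "Q y + d \<in> mfs_apply \<Phi> V (col (Q y + d))" by (simp add: VV)
    then obtain j f y' where f: "f \<in> \<Phi> (col (Q y + d)) j" "y' \<in> V j" "Q y + d = f y'"
      by (auto simp: mfs_apply_def)
    obtain d' where d': "d' \<in> D" "f = (\<lambda>x. Q x + d')" using maps[OF f(1)] by blast
    have "Q y + d - d' = Q y'" using f(3) d'(2) by (simp add: algebra_simps)
    then have "Q y + d - d' \<in> Q ` L" using V_L[OF f(2)] by simp
    moreover have "Q y + d - d \<in> Q ` L" using y by simp
    ultimately have "d' = d" using D_unique[OF yd] d d'(1) by blast
    then have "Q y = Q y'" using f(3) d'(2) by simp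
    then have "y = y'" using inj by (simp add: inj_eq)
    then have "col y = j" using f(2) col_iff[OF y] by simp
    then show ?thesis using f(1) d'(2) \<open>d' = d\<close> by simp
  qed
  have diff_module: "diff_module V = color_module L col"
    unfolding L_def by (rule diff_module_eq_color_module) (use col_iff in \<open>simp add: L_def\<close>)
  interpret coincidence_free_coloring Q L D col
  proof
    show "Q (x - y) = Q x - Q y" for x y by (rule linear_diff[OF lin])
    show "0 \<in> L" "\<And>x y. \<lbrakk>x \<in> L; y \<in> L\<rbrakk> \<Longrightarrow> x - y \<in> L" "finite (L \<inter> cball 0 r)" for r
      using L by auto
    show "Q x \<in> L" if "x \<in> L" for x using Q_L that .
    show "D \<subseteq> L" "0 \<in> D" using D_L D(2) .
    show "\<exists>y\<in>L. \<exists>d\<in>D. z = Q y + d" if z: "z \<in> L" for z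
    proof -
      obtain d y where "d \<in> D" "y \<in> L" "z - d = Q y" using D_unique[OF z] by blast
      then show ?thesis by (intro bexI[of _ y] bexI[of _ d]) (auto simp: algebra_simps)
    qed
    show "col (Q x + d) = col (Q y + d)" if "x \<in> L" "y \<in> L" "d \<in> D" "col x = col y" for x y d
    proof -
      have "y \<in> V (col x)" using iffD1[OF col_iff[OF that(2)] that(4)[symmetric]] .
      then have "Q y + d \<in> V (col (Q x + d))"
        by (rule map_V[OF map_in_\<Phi>[OF that(1,3)]])
      then show ?thesis using col_iff[of "Q y + d"] V_L by metis
    qed
    show "col x = col y" if xy: "x \<in> L" "y \<in> L" "x - y \<in> color_module L col" "d \<in> D"
      "col (Q x + d) = col (Q y + d)" for x y d
    proof (rule ccontr)
      assume ne: "col x \<noteq> col y"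
      have "0 \<in> diff_module V" unfolding diff_module color_module_def by simp
      then have "y \<in> (+) y ` diff_module V" by (intro image_eqI[of _ _ 0]) auto
      moreover have "x \<in> (+) y ` diff_module V"
        using xy(3) unfolding diff_module by (intro image_eqI[of _ _ "x - y"]) auto
      moreover have "x \<in> V (col x)" "y \<in> V (col y)" using xy col_iff by auto
      ultimately have "col x \<in> Psi0 V y" "col y \<in> Psi0 V y" by (auto simp: Psi0_def)
      moreover have "\<Phi> (col (Q x + d)) (col x) \<inter> \<Phi> (col (Q x + d)) (col y) \<noteq> {}"
        using map_in_\<Phi>[OF xy(1,4)] map_in_\<Phi>[OF xy(2,4)] xy(5) by auto
      ultimately show False using no_coincidence ne xy(2) unfolding L_def by blast
    qed
    show "\<exists>k w. \<forall>f\<in>L \<inter> cball 0 r. w + f \<in> digit_sums Q D k" for r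
    proof -
      \<comment> \<open>Legality concerns positive radii only.\<close>
      have "max r 1 > 0" by simp
      then obtain k i p t where cl: "\<And>j. (+) t ` (V j \<inter> cball 0 (max r 1))
          \<subseteq> mfs_apply (mfs_power \<Phi> k) (point_of_type i p) j"
        using assms(2) unfolding clusters_legal_def by meson
      have "t - (Q ^^ k) p + f \<in> digit_sums Q D k" if f: "f \<in> L \<inter> cball 0 r" for f
      proof -
        have "f \<in> V (col f) \<inter> cball 0 (max r 1)" using f col_iff by auto
        then have "t + f \<in> mfs_apply (mfs_power \<Phi> k) (point_of_type i p) (col f)"
          using cl by blast
        then obtain g where g: "g \<in> mfs_power \<Phi> k (col f) i" "t + f = g p"
          by (auto simp: mfs_apply_def point_of_type_def split: if_splits)
        obtain e where "e \<in> digit_sums Q D k" "g = (\<lambda>x. (Q ^^ k) x + e)"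
          using mfs_power_digit_sums[of Q \<Phi> D, OF lin _ g(1)] maps by blast
        moreover from this have "t - (Q ^^ k) p + f = e" using g(2) by (simp add: algebra_simps)
        ultimately show ?thesis by simp
      qed
      then show ?thesis by blast
    qed
  qed
  have "model_set TYPE('h) (V (col 0))" using assms(4) by blast
  then obtain x B r where x: "x \<in> V (col 0)" and B: "0 \<in> B" "\<And>b. b \<in> B \<Longrightarrow> - b \<in> B"
    "\<And>a b c. \<lbrakk>a \<in> B; b \<in> B; c \<in> B\<rbrakk> \<Longrightarrow> x + a + b + c \<in> V (col 0)" "\<And>z. \<exists>b\<in>B. norm (z - b) \<le> r"
    by (rule model_set_almost_periods) blast
  have shift: "x + a + b + c \<in> L \<and> col (x + a + b + c) = col x" if "a \<in> B" "b \<in> B" "c \<in> B" for a b c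
    using B(3)[OF that] x V_L col_iff by metis
  obtain F where F: "finite F" "F \<subseteq> L" "\<And>y. y \<in> L \<Longrightarrow> \<exists>f\<in>F. y - f \<in> periods"
    using almost_periods_imp_finite_index[OF B(1,2) V_L[OF x] shift B(4)] by blast
  have L'_periods: "color_module L col \<subseteq> periods" by (rule finite_index_imp_color_module_periods[OF F])
  have "Psi0 V 0 = {col 0}"
  proof
    show "{col 0} \<subseteq> Psi0 V 0"
    proof -
      have "0 \<in> color_module L col" by (simp add: color_module_def)
      then show ?thesis using col_iff[OF L(1)] by (auto simp: Psi0_def diff_module)
    qed
    show "Psi0 V 0 \<subseteq> {col 0}"
    proof
      fix i assume "i \<in> Psi0 V 0"
      then obtain u where u: "u \<in> color_module L col" "u \<in> V i" by (auto simp: Psi0_def diff_module)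
      then have "col (0 + u) = col 0" using L'_periods L(1) by (intro periodsD) auto
      moreover have "col u = i" using col_iff[OF V_L[OF u(2)]] u(2) by blast
      ultimately show "i \<in> {col 0}" by simp
    qed
  qed
  then show False using assms(3) L(1) by (auto simp: L_def)
qed

end
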